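(* Let $P=\{p_1,\ldots,p_n\}$ be a finite partially ordered set with $|P|=n\ge1$, let $K$ be a field, and let $S=K[x_1,\ldots,x_n,y_1,\ldots,y_n]$ with all variables of degree $1$. Let $H_P\subset S$ be the monomial ideal generated by the monomials $$u_I=\Big(\prod_{p_i\in I}x_i\Big)\Big(\prod_{p_i\in P\setminus I}y_i\Big),$$ where $I$ ranges over all poset ideals of $P$. Then each power $H_P^k$, $k\ge1$, has linear quotients.
   Context: A poset ideal of $P$ is a subset $I\subset P$ such that if $x\in I$, $y\in P$ and $y\le x$, then $y\in I$ (the empty set and $P$ are poset ideals). A sequence $f_1,\ldots,f_s$ of homogeneous elements of $S$ with $0<\deg f_1\le\cdots\le\deg f_s$ has linear quotients if for each $2\le j\le s$ the colon ideal $(f_1,\ldots,f_{j-1}):f_j$ is generated by linear forms. A graded ideal has linear quotients if it is generated by a sequence with linear quotients. *)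

theory Defs
  imports Complex_Main "HOL-Library.Poly_Mapping"
begin

subsection \<open>Ideals of a commutative ring\<close>

text \<open>\<^term>\<open>module.span (*)\<close> is the span in the ring regarded as a module over itself,
  i.e. the set of all finite sums \<open>\<Sum>b\<in>t. r b * b\<close> with \<open>t \<subseteq> B\<close>.\<close>

definition ideal_of :: "'r::comm_ring_1 set \<Rightarrow> 'r set" where
  "ideal_of B = module.span (*) B"

lemma module_times: "module ((*) :: 'r::comm_ring_1 \<Rightarrow> 'r \<Rightarrow> 'r)"
  by standard (simp_all add: algebra_simps)

definition ideal_product :: "'r::comm_ring_1 set \<Rightarrow> 'r set \<Rightarrow> 'r set" where
  "ideal_product I J = ideal_of {a * b | a b. a \<in> I \<and> b \<in> J}"

primrec ideal_power :: "'r::comm_ring_1 set \<Rightarrow> nat \<Rightarrow> 'r set" where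
  "ideal_power I 0 = UNIV"
| "ideal_power I (Suc k) = ideal_product I (ideal_power I k)"

definition colon_ideal :: "'r::comm_ring_1 set \<Rightarrow> 'r \<Rightarrow> 'r set" where
  "colon_ideal I f = {g. g * f \<in> I}"


subsection \<open>Polynomial rings with the standard grading\<close>

text \<open>A polynomial is a finitely supported function from monomials to coefficients, a monomial
  a finitely supported function from variables to exponents; multiplication of
  polynomials is the convolution product of \<^type>\<open>poly_mapping\<close>.\<close>

type_synonym ('v, 'k) polynomial = "('v \<Rightarrow>\<^sub>0 nat) \<Rightarrow>\<^sub>0 'k"

definition Var :: "'v \<Rightarrow> ('v, 'k::comm_ring_1) polynomial" where
  "Var v = Poly_Mapping.single (Poly_Mapping.single v 1) 1"

definition monomial_degree :: "('v \<Rightarrow>\<^sub>0 nat) \<Rightarrow> nat" where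
  "monomial_degree m = (\<Sum>v\<in>Poly_Mapping.keys m. Poly_Mapping.lookup m v)"

text \<open>The total degree; the zero polynomial is given degree \<open>0\<close>.\<close>

definition total_degree :: "('v, 'k::zero) polynomial \<Rightarrow> nat" where
  "total_degree f = Max (insert 0 (monomial_degree ` Poly_Mapping.keys f))"

definition homogeneous :: "('v, 'k::zero) polynomial \<Rightarrow> bool" where
  "homogeneous f \<longleftrightarrow> (\<exists>d. \<forall>m\<in>Poly_Mapping.keys f. monomial_degree m = d)"

definition linear_form :: "('v, 'k::zero) polynomial \<Rightarrow> bool" where
  "linear_form f \<longleftrightarrow> (\<forall>m\<in>Poly_Mapping.keys f. monomial_degree m = 1)"


subsection \<open>Linear quotients\<close>

text \<open>Lists are indexed from \<open>0\<close>, so the colon ideal \<open>(f\<^sub>1, \<dots>, f\<^bsub>j-1\<^esub>) : f\<^sub>j\<close> with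
  \<open>2 \<le> j \<le> s\<close> appears below as the one at index \<open>j\<close> with \<open>1 \<le> j < s\<close>. The degree condition
  excludes zero entries, because \<^term>\<open>total_degree 0 = 0\<close>.\<close>

definition linear_quotients_seq :: "('v, 'k::comm_ring_1) polynomial list \<Rightarrow> bool" where
  "linear_quotients_seq fs \<longleftrightarrow>
     fs \<noteq> [] \<and>
     (\<forall>f\<in>set fs. homogeneous f) \<and>
     0 < total_degree (hd fs) \<and> sorted (map total_degree fs) \<and>
     (\<forall>j. 1 \<le> j \<and> j < length fs \<longrightarrow>
        (\<exists>L. (\<forall>l\<in>L. linear_form l) \<and>
             colon_ideal (ideal_of (set (take j fs))) (fs ! j) = ideal_of L))"

text \<open>An ideal satisfying this predicate is automatically graded, since the elements of the
  sequence are homogeneous.\<close>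

definition has_linear_quotients :: "('v, 'k::comm_ring_1) polynomial set \<Rightarrow> bool" where
  "has_linear_quotients I \<longleftrightarrow> (\<exists>fs. linear_quotients_seq fs \<and> I = ideal_of (set fs))"


subsection \<open>The ideal of a finite poset\<close>

text \<open>The poset \<open>P\<close> is a type \<^typ>\<open>'p\<close> of sort \<open>{finite, order}\<close>; its elements themselves serve
  as the indices of the variables \<open>x\<^sub>i\<close> and \<open>y\<^sub>i\<close>. As types are inhabited, \<open>|P| \<ge> 1\<close>.\<close>

datatype 'p xy_var = X 'p | Y 'p

definition poset_ideal :: "'p::order set \<Rightarrow> bool" where
  "poset_ideal I \<longleftrightarrow> (\<forall>x\<in>I. \<forall>y. y \<le> x \<longrightarrow> y \<in> I)"

definition u_monomial :: "'p::finite set \<Rightarrow> ('p xy_var, 'k::field) polynomial" where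
  "u_monomial I = (\<Prod>p\<in>I. Var (X p)) * (\<Prod>p\<in>UNIV - I. Var (Y p))"

definition H_ideal :: "('p::{finite,order} xy_var, 'k::field) polynomial set" where
  "H_ideal = ideal_of {u_monomial I | I. poset_ideal I}"

end

(* Since u_I u_J = u_(I Int J) u_(I Un J), the generators of H_P^k are the monomials
   m_f = prod_p x_p^(f p) y_p^(k - f p) with f : P -> {0..k} antitone. Order them by the sum of
   the values of f. If m_e comes before m_f, then e p < f p for some p; for a maximal such p the
   function f' obtained from f by lowering its value at p by one is again antitone. Now
   y_p m_f = x_p m_f', where m_f' comes before m_f, and y_p divides m_e / gcd(m_e, m_f). Hence the
   colon ideal is generated by variables y_p. *)
theory Submission
  imports Defs "HOL-Library.FuncSet"
begin

subsection \<open>Ideals\<close>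

lemma ideal_of_base: "a \<in> B \<Longrightarrow> a \<in> ideal_of B"
  unfolding ideal_of_def by (rule module.span_base[OF module_times])

lemma ideal_of_0: "0 \<in> ideal_of B"
  unfolding ideal_of_def by (rule module.span_zero[OF module_times])

lemma ideal_of_add: "a \<in> ideal_of B \<Longrightarrow> b \<in> ideal_of B \<Longrightarrow> a + b \<in> ideal_of B"
  unfolding ideal_of_def by (rule module.span_add[OF module_times])

lemma ideal_of_mult: "a \<in> ideal_of B \<Longrightarrow> c * a \<in> ideal_of B"
  unfolding ideal_of_def by (rule module.span_scale[OF module_times])

lemma ideal_of_sum: "(\<And>i. i \<in> A \<Longrightarrow> g i \<in> ideal_of B) \<Longrightarrow> sum g A \<in> ideal_of B"
  unfolding ideal_of_def by (rule module.span_sum[OF module_times])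

lemma ideal_of_induct [consumes 1, case_names zero step]:
  assumes "a \<in> ideal_of B"
    and "P 0"
    and "\<And>c b x. b \<in> B \<Longrightarrow> P x \<Longrightarrow> P (c * b + x)"
  shows "P a"
  using assms unfolding ideal_of_def by (rule module.span_induct_alt[OF module_times])

lemma ideal_of_subsetI:
  assumes "B \<subseteq> ideal_of C"
  shows "ideal_of B \<subseteq> ideal_of C"
proof
  fix a assume "a \<in> ideal_of B"
  then show "a \<in> ideal_of C"
  proof (induction rule: ideal_of_induct)
    case (step c b x)
    then show ?case using assms by (intro ideal_of_add ideal_of_mult) auto
  qed (rule ideal_of_0)
qed

lemma ideal_of_eq_UNIV: "1 \<in> B \<Longrightarrow> ideal_of B = UNIV"
  using ideal_of_mult[OF ideal_of_base, of 1 B] by (metis UNIV_eq_I mult.right_neutral)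

text \<open>Multiplication is linear in each factor: induct on the second factor with a generator
  \<open>a\<close> fixed, then on the first. Hence powers can be computed on generators
  alone.\<close>

lemma ideal_product_ideal_of:
  "ideal_product (ideal_of A) (ideal_of B) = ideal_of {a * b | a b. a \<in> A \<and> b \<in> B}"
    (is "_ = ideal_of ?C")
proof
  have AB: "a * b \<in> ideal_of ?C" if "a \<in> A" "b \<in> ideal_of B" for a b
    using that(2)
  proof (induction rule: ideal_of_induct)
    case (step c b x)
    have "c * (a * b) + a * x \<in> ideal_of ?C"
      using that(1) step(1)
      by (intro ideal_of_add[OF ideal_of_mult[OF ideal_of_base] step(2)]) blast
    then show ?case by (simp add: algebra_simps)
  qed (simp add: ideal_of_0)
  have "a * b \<in> ideal_of ?C" if "a \<in> ideal_of A" "b \<in> ideal_of B" for a b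
    using that(1)
  proof (induction rule: ideal_of_induct)
    case (step c a x)
    have "c * (a * b) + x * b \<in> ideal_of ?C"
      using AB[OF step(1) that(2)] step(2) by (rule ideal_of_add[OF ideal_of_mult])
    then show ?case by (simp add: algebra_simps)
  qed (simp add: ideal_of_0)
  then show "ideal_product (ideal_of A) (ideal_of B) \<subseteq> ideal_of ?C"
    unfolding ideal_product_def by (intro ideal_of_subsetI) blast
  show "ideal_of ?C \<subseteq> ideal_product (ideal_of A) (ideal_of B)"
    unfolding ideal_product_def by (intro ideal_of_subsetI) (blast intro: ideal_of_base)
qed


subsection \<open>Monomials\<close>

abbreviation monom_poly :: "('v \<Rightarrow>\<^sub>0 nat) \<Rightarrow> ('v, 'k::comm_ring_1) polynomial" where
  "monom_poly m \<equiv> Poly_Mapping.single m 1"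

lemma prod_monom_poly: "(\<Prod>i\<in>A. monom_poly (m i)) = monom_poly (\<Sum>i\<in>A. m i)"
  by (induction A rule: infinite_finite_induct) (simp_all add: mult_single)

text \<open>Divisibility of monomials is written additively as \<open>t = s + m\<close>. A multiple
  of \<open>monom_poly m\<close> has only keys divisible by \<open>m\<close>, and adding polynomials
  creates no new keys.\<close>

lemma keys_monom_ideal:
  assumes "h \<in> ideal_of (monom_poly ` M)" "t \<in> Poly_Mapping.keys h"
  shows "\<exists>m\<in>M. \<exists>s. t = s + m"
  using assms
proof (induction arbitrary: t rule: ideal_of_induct)
  case (step c b x)
  from step.hyps obtain m where m: "m \<in> M" "b = monom_poly m" by blast
  from step.prems consider "t \<in> Poly_Mapping.keys (c * b)" | "t \<in> Poly_Mapping.keys x"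
    using Poly_Mapping.keys_add[of "c * b" x] by blast
  then show ?case
  proof cases
    case 1
    then obtain s where "t = s + m"
      using keys_mult[of c b] m(2) by (auto split: if_splits)
    with m(1) show ?thesis by blast
  qed (rule step.IH)
qed simp

text \<open>Addition of exponents is cancellative, so only the pair \<open>(t, m)\<close>
  contributes to the convolution at \<open>t + m\<close>. Multiplying by a monomial therefore shifts
  the support without cancellation.\<close>

lemma lookup_mult_monom_poly:
  "Poly_Mapping.lookup (g * monom_poly m) (t + m) = Poly_Mapping.lookup g t"
proof -
  have "Poly_Mapping.lookup (g * monom_poly m) (t + m)
      = (\<Sum>s. (Poly_Mapping.lookup g s * (\<Sum>q. ((1 when m = q) when t + m = s + q))))"
    by (simp add: lookup_mult lookup_single)
  also have "(\<lambda>s. Poly_Mapping.lookup g s * (\<Sum>q. ((1 when m = q) when t + m = s + q)))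
      = (\<lambda>s. Poly_Mapping.lookup g s when s = t)"
  proof
    fix s
    have "(\<lambda>q. ((1::'a) when m = q) when t + m = s + q) = (\<lambda>q. (1 when s = t) when q = m)"
      by (auto simp: when_def fun_eq_iff)
    then have "(\<Sum>q. ((1::'a) when m = q) when t + m = s + q) = (1 when s = t)"
      by (simp only: Sum_any_when_equal)
    then show "Poly_Mapping.lookup g s * (\<Sum>q. ((1 when m = q) when t + m = s + q))
        = (Poly_Mapping.lookup g s when s = t)"
      by (simp add: when_def)
  qed
  finally show ?thesis by simp
qed

lemma keys_mult_monom_poly: "t \<in> Poly_Mapping.keys g \<Longrightarrow> t + m \<in> Poly_Mapping.keys (g * monom_poly m)"
  by (simp add: in_keys_iff lookup_mult_monom_poly)

text \<open>A converse to \<open>keys_monom_ideal\<close>: \<open>g\<close> is the sum of its terms,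
  and each of them is a multiple of a monomial in \<open>B\<close>.\<close>

lemma mem_ideal_of_terms:
  assumes "\<And>t. t \<in> Poly_Mapping.keys g \<Longrightarrow> \<exists>m s. monom_poly m \<in> B \<and> t = s + m"
  shows "g \<in> ideal_of B"
proof -
  have "Poly_Mapping.single t (Poly_Mapping.lookup g t) \<in> ideal_of B"
    if t: "t \<in> Poly_Mapping.keys g" for t
  proof -
    obtain m s where ms: "monom_poly m \<in> B" "t = s + m" using assms[OF t] by blast
    have "Poly_Mapping.single s (Poly_Mapping.lookup g t) * monom_poly m \<in> ideal_of B"
      using ms(1) by (intro ideal_of_mult ideal_of_base)
    then show ?thesis by (simp add: ms(2) mult_single)
  qed
  then have "(\<Sum>t\<in>Poly_Mapping.keys g. Poly_Mapping.single t (Poly_Mapping.lookup g t)) \<in> ideal_of B"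
    by (rule ideal_of_sum)
  also have "(\<Sum>t\<in>Poly_Mapping.keys g. Poly_Mapping.single t (Poly_Mapping.lookup g t)) = g"
    by (rule poly_mapping_eqI) (auto simp: lookup_sum lookup_single when_def in_keys_iff)
  finally show ?thesis .
qed

lemma homogeneous_monom_poly: "homogeneous (monom_poly m)"
  by (simp add: homogeneous_def)

lemma total_degree_monom_poly:
  "total_degree (monom_poly m :: ('v, 'k::comm_ring_1) polynomial) = monomial_degree m"
  by (simp add: total_degree_def)

lemma monomial_degree_superset:
  assumes "finite A" "Poly_Mapping.keys m \<subseteq> A"
  shows "monomial_degree m = (\<Sum>v\<in>A. Poly_Mapping.lookup m v)"
  unfolding monomial_degree_def
  by (rule sum.mono_neutral_left) (use assms in \<open>auto simp: in_keys_iff\<close>)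

lemma linear_form_Var: "linear_form (Var v)"
  by (simp add: linear_form_def Var_def monomial_degree_def)


subsection \<open>Generators of the powers\<close>

text \<open>The exponent vector of the monomial m_f. Subtraction is truncated, so
  \<open>k - f p\<close> is the intended exponent only when \<open>f p \<le> k\<close>.\<close>

definition exponents :: "nat \<Rightarrow> ('p::finite \<Rightarrow> nat) \<Rightarrow> ('p xy_var \<Rightarrow>\<^sub>0 nat)" where
  "exponents k f = (\<Sum>p\<in>UNIV. Poly_Mapping.single (X p) (f p) + Poly_Mapping.single (Y p) (k - f p))"

lemma lookup_exponents [simp]:
  "Poly_Mapping.lookup (exponents k f) (X p) = f p"
  "Poly_Mapping.lookup (exponents k f) (Y p) = k - f p"
  by (simp_all add: exponents_def lookup_sum lookup_add lookup_single when_def)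

lemma xy_poly_mapping_eqI:
  assumes "\<And>p. Poly_Mapping.lookup m (X p) = Poly_Mapping.lookup n (X p)"
    and "\<And>p. Poly_Mapping.lookup m (Y p) = Poly_Mapping.lookup n (Y p)"
  shows "m = n"
  using assms by (intro poly_mapping_eqI) (metis xy_var.exhaust)

text \<open>For each \<open>p\<close> the exponents of x_p and y_p add up to \<open>k\<close>. All
  generators thus share one degree, whatever order they are listed in.\<close>

lemma monomial_degree_exponents:
  fixes f :: "'p::finite \<Rightarrow> nat"
  assumes "\<And>p. f p \<le> k"
  shows "monomial_degree (exponents k f) = k * card (UNIV :: 'p set)"
proof -
  have "monomial_degree (exponents k f)
      = (\<Sum>v\<in>range X \<union> range Y. Poly_Mapping.lookup (exponents k f) v)"
    by (rule monomial_degree_superset) (simp, metis UnCI rangeI subsetI xy_var.exhaust)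
  also have "\<dots> = (\<Sum>v\<in>range X. Poly_Mapping.lookup (exponents k f) v)
      + (\<Sum>v\<in>range Y. Poly_Mapping.lookup (exponents k f) v)"
    by (rule sum.union_disjoint) auto
  also have "\<dots> = (\<Sum>p\<in>UNIV. f p + (k - f p))"
    by (simp add: sum.reindex inj_on_def sum.distrib)
  finally show ?thesis using assms by simp
qed

lemma u_monomial_eq: "u_monomial I = monom_poly (exponents 1 (\<lambda>p. of_bool (p \<in> I)))"
proof -
  have "u_monomial I = (monom_poly ((\<Sum>p\<in>I. Poly_Mapping.single (X p) 1)
      + (\<Sum>p\<in>UNIV - I. Poly_Mapping.single (Y p) 1)) :: ('a xy_var, 'b) polynomial)"
    by (simp add: u_monomial_def Var_def prod_monom_poly mult_single)
  also have "(\<Sum>p\<in>I. Poly_Mapping.single (X p) 1) + (\<Sum>p\<in>UNIV - I. Poly_Mapping.single (Y p) 1)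
      = exponents 1 (\<lambda>p. of_bool (p \<in> I))"
    by (rule xy_poly_mapping_eqI) (simp_all add: lookup_add lookup_sum lookup_single when_def)
  finally show ?thesis .
qed

lemma exponents_add:
  assumes "\<And>p. e p \<le> j" "\<And>p. f p \<le> k"
  shows "exponents j e + exponents k f = exponents (j + k) (\<lambda>p. e p + f p)"
  by (rule xy_poly_mapping_eqI) (use assms in \<open>simp_all add: lookup_add\<close>)

text \<open>Sums of the indicator functions of \<open>k\<close> poset ideals; antitone because poset
  ideals are closed downwards.\<close>

definition antitone_maps :: "nat \<Rightarrow> ('p::order \<Rightarrow> nat) set" where
  "antitone_maps k = {f. antimono f \<and> (\<forall>p. f p \<le> k)}"

lemma finite_antitone_maps: "finite (antitone_maps k :: ('p::{finite,order} \<Rightarrow> nat) set)"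
proof (rule finite_subset)
  show "antitone_maps k \<subseteq> PiE (UNIV :: 'p set) (\<lambda>_. {..k})"
    by (auto simp: antitone_maps_def)
  show "finite (PiE (UNIV :: 'p set) (\<lambda>_. {..k}))"
    by (rule finite_PiE) auto
qed

text \<open>Induction on \<open>k\<close>: adding the indicator of a poset ideal to an antitone map
  gives an antitone map with bound \<open>Suc k\<close>, and every such map arises by splitting off
  the indicator of its support.\<close>

lemma ideal_power_H_ideal:
  "ideal_power (H_ideal :: ('p::{finite,order} xy_var, 'k::field) polynomial set) k
    = ideal_of ((\<lambda>f. monom_poly (exponents k f)) ` antitone_maps k)"
proof (induction k)
  case 0
  \<comment> \<open>The zeroth power is the whole ring, and the only generator for
    \<open>k = 0\<close> is the monomial 1.\<close>
  have "exponents 0 (\<lambda>p::'p. 0) = 0"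
    by (rule xy_poly_mapping_eqI) simp_all
  moreover have "(\<lambda>p::'p. 0) \<in> antitone_maps 0"
    by (simp add: antitone_maps_def monotone_on_def)
  ultimately have "1 \<in> (\<lambda>f. monom_poly (exponents 0 f) :: ('p xy_var, 'k) polynomial) ` antitone_maps 0"
    by (metis (mono_tags, lifting) image_eqI single_one)
  then show ?case by (simp add: ideal_of_eq_UNIV)
next
  case (Suc k)
  have mult: "u_monomial I * monom_poly (exponents k f)
      = (monom_poly (exponents (Suc k) (\<lambda>p. of_bool (p \<in> I) + f p)) :: ('p xy_var, 'k) polynomial)"
    if "f \<in> antitone_maps k" for I f
    using that by (simp add: u_monomial_eq mult_single exponents_add antitone_maps_def)
  have "{a * b | a b. a \<in> {u_monomial I | I. poset_ideal I} \<and>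
          b \<in> (\<lambda>f. monom_poly (exponents k f)) ` antitone_maps k}
      = ((\<lambda>f. monom_poly (exponents (Suc k) f)) ` antitone_maps (Suc k)
          :: ('p xy_var, 'k) polynomial set)" (is "?L = ?R")
  proof (intro equalityI subsetI)
    fix g assume "g \<in> ?L"
    then obtain I f where I: "poset_ideal I" and f: "f \<in> antitone_maps k"
      and g: "g = u_monomial I * monom_poly (exponents k f)"
      by blast
    have "(\<lambda>p. of_bool (p \<in> I) + f p) \<in> antitone_maps (Suc k)"
    proof -
      have "of_bool (q \<in> I) + f q \<le> of_bool (p \<in> I) + f p" if "p \<le> q" for p q
        using that I f by (intro add_mono) (auto simp: poset_ideal_def antitone_maps_def antimonoD)
      moreover have "of_bool (p \<in> I) + f p \<le> Suc k" for p
        using f by (simp add: antitone_maps_def le_SucI)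
      ultimately show ?thesis by (simp add: antitone_maps_def antimono_def)
    qed
    then show "g \<in> ?R" by (simp add: g mult[OF f])
  next
    fix g assume "g \<in> ?R"
    then obtain f where f: "f \<in> antitone_maps (Suc k)" and g: "g = monom_poly (exponents (Suc k) f)"
      by blast
    \<comment> \<open>The support of \<open>f\<close> is a poset ideal since \<open>f\<close> is
      antitone. Truncated subtraction leaves \<open>?e\<close> equal to 0 outside it, so adding back
      the indicator recovers \<open>f\<close>.\<close>
    let ?I = "{p. 0 < f p}"
    let ?e = "\<lambda>p. f p - 1"
    have mono: "f q \<le> f p" if "p \<le> q" for p q
      using f that by (simp add: antitone_maps_def antimonoD)
    have "poset_ideal ?I"
      unfolding poset_ideal_def using mono by (auto intro: less_le_trans)
    moreover have e: "?e \<in> antitone_maps k"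
    proof -
      have "f p - 1 \<le> k" for p using f by (simp add: antitone_maps_def le_diff_conv)
      moreover have "f q - 1 \<le> f p - 1" if "p \<le> q" for p q
        using mono[OF that] by (rule diff_le_mono)
      ultimately show ?thesis unfolding antitone_maps_def antimono_def by blast
    qed
    moreover have "(\<lambda>p. of_bool (p \<in> ?I) + ?e p) = f" by (auto simp: fun_eq_iff)
    ultimately have "g = u_monomial ?I * monom_poly (exponents k ?e)" "poset_ideal ?I"
      using mult[OF e, of ?I] g by simp_all
    with e show "g \<in> ?L" by blast
  qed
  moreover have "ideal_power (H_ideal :: ('p xy_var, 'k) polynomial set) (Suc k)
      = ideal_product H_ideal (ideal_of ((\<lambda>f. monom_poly (exponents k f)) ` antitone_maps k))"
    by (simp only: ideal_power.simps Suc.IH)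
  ultimately show ?case by (simp only: H_ideal_def ideal_product_ideal_of)
qed


subsection \<open>Linear quotients\<close>

text \<open>Take \<open>p\<close> maximal with \<open>e p < f p\<close>. Every \<open>q\<close>
  above \<open>p\<close> satisfies \<open>f q \<le> e q \<le> e p < f p\<close>, which leaves room
  to lower \<open>f\<close> at \<open>p\<close>. The weak inequality of sums also covers ties in the
  ordering.\<close>

lemma antitone_maps_lower:
  fixes e f :: "'p::{finite,order} \<Rightarrow> nat"
  assumes e: "e \<in> antitone_maps k" and f: "f \<in> antitone_maps k"
    and le: "sum e UNIV \<le> sum f UNIV" and ne: "e \<noteq> f"
  obtains p where "e p < f p" "f(p := f p - 1) \<in> antitone_maps k"
proof -
  have "{p. e p < f p} \<noteq> {}"
  proof
    assume "{p. e p < f p} = {}"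
    \<comment> \<open>Otherwise \<open>f\<close> lies pointwise below \<open>e\<close> and strictly
      so somewhere, which contradicts the comparison of sums.\<close>
    then have fe: "f p \<le> e p" for p by (simp add: not_less)
    obtain q where "e q \<noteq> f q" using ne by (auto simp: fun_eq_iff)
    with fe[of q] have "f q < e q" by simp
    with fe have "sum f UNIV < sum e UNIV" by (intro sum_strict_mono_ex1) auto
    with le show False by simp
  qed
  then obtain p where p: "e p < f p" and max: "\<And>q. e q < f q \<Longrightarrow> p \<le> q \<Longrightarrow> p = q"
    using finite_has_maximal[of "{p. e p < f p}"] by (metis (mono_tags, lifting) finite mem_Collect_eq)
  have gt: "f q \<le> f p - 1" if "p < q" for q
  proof -
    have "f q \<le> e q" using max[of q] that by (metis leI less_le)
    also have "e q \<le> e p" using e that by (simp add: antitone_maps_def antimonoD)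
    finally show ?thesis using p by simp
  qed
  have "(f(p := f p - 1)) s \<le> (f(p := f p - 1)) r" if "r \<le> s" for r s
  proof -
    have le: "f s \<le> f r" using f that by (simp add: antitone_maps_def antimonoD)
    show ?thesis
    \<comment> \<open>Lowering the value at \<open>p\<close> can only endanger comparisons of
      \<open>p\<close> with a strictly larger element.\<close>
    proof (cases "r = p \<and> s \<noteq> p")
      case True
      with that have "p < s" by auto
      from gt[OF this] True show ?thesis by simp
    next
      case False
      with le show ?thesis by auto
    qed
  qed
  moreover have "(f(p := f p - 1)) q \<le> k" for q
    using f by (auto simp: antitone_maps_def intro: order_trans[OF diff_le_self])
  ultimately have "f(p := f p - 1) \<in> antitone_maps k"
    by (simp add: antitone_maps_def antimono_def)
  with p show thesis by (rule that)
qed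

text \<open>\<open>A\<close> stands for the generators listed before \<open>f\<close> when sorting
  by sum: all maps of smaller sum, and any choice among the ties. One inclusion compares monomials;
  the other trades y_p for x_p while lowering \<open>f\<close> at \<open>p\<close>.\<close>

lemma colon_ideal_antitone_maps:
  fixes f :: "'p::{finite,order} \<Rightarrow> nat"
  assumes f: "f \<in> antitone_maps k" and A: "A \<subseteq> antitone_maps k" and "f \<notin> A"
    and before: "\<And>e. e \<in> A \<Longrightarrow> sum e UNIV \<le> sum f UNIV"
    and lower: "\<And>e. e \<in> antitone_maps k \<Longrightarrow> sum e UNIV < sum f UNIV \<Longrightarrow> e \<in> A"
  shows "colon_ideal (ideal_of ((\<lambda>e. monom_poly (exponents k e)) ` A)) (monom_poly (exponents k f))
    = ideal_of ((\<lambda>p. Var (Y p)) ` {p. 0 < f p \<and> f(p := f p - 1) \<in> antitone_maps k}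
        :: ('p xy_var, 'k::field) polynomial set)"
    (is "colon_ideal (ideal_of ?M) ?f = ideal_of ?L")
proof (intro equalityI subsetI)
  fix g assume "g \<in> colon_ideal (ideal_of ?M) ?f"
  then have g: "g * ?f \<in> ideal_of (monom_poly ` exponents k ` A)"
    by (simp add: colon_ideal_def image_image)
  show "g \<in> ideal_of ?L"
  proof (rule mem_ideal_of_terms)
    fix t assume "t \<in> Poly_Mapping.keys g"
    then have "t + exponents k f \<in> Poly_Mapping.keys (g * ?f)" by (rule keys_mult_monom_poly)
    with keys_monom_ideal[OF g] obtain e s
      where e: "e \<in> A" and s: "t + exponents k f = s + exponents k e" by blast
    from e A before \<open>f \<notin> A\<close> have "e \<in> antitone_maps k" "sum e UNIV \<le> sum f UNIV" "e \<noteq> f" by auto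
    then obtain p where p: "e p < f p" "f(p := f p - 1) \<in> antitone_maps k"
      using f by (metis antitone_maps_lower)
    \<comment> \<open>The exponent of y_p is \<open>k - e p\<close> in m_e and strictly smaller in
      m_f, so \<open>t\<close> must supply a factor y_p.\<close>
    have "Poly_Mapping.lookup t (Y p) + (k - f p) = Poly_Mapping.lookup s (Y p) + (k - e p)"
      using arg_cong[OF s, of "\<lambda>m. Poly_Mapping.lookup m (Y p)"] by (simp add: lookup_add)
    moreover have "f p \<le> k" using f by (simp add: antitone_maps_def)
    ultimately have pos: "0 < Poly_Mapping.lookup t (Y p)" using p(1) by linarith
    have "t = (t - Poly_Mapping.single (Y p) 1) + Poly_Mapping.single (Y p) 1"
      using pos by (intro poly_mapping_eqI) (auto simp: lookup_add lookup_minus lookup_single when_def)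
    moreover have "monom_poly (Poly_Mapping.single (Y p) 1) \<in> ?L"
      using p by (auto simp: Var_def)
    ultimately show "\<exists>m s. monom_poly m \<in> ?L \<and> t = s + m" by blast
  qed
next
  fix g assume "g \<in> ideal_of ?L"
  then have "g * ?f \<in> ideal_of ?M"
  proof (induction rule: ideal_of_induct)
    case (step c b x)
    then obtain p where b: "b = Var (Y p)" and p: "0 < f p" "f(p := f p - 1) \<in> antitone_maps k"
      by blast
    let ?f' = "f(p := f p - 1)"
    have "sum ?f' UNIV < sum f UNIV"
      using p(1) by (intro sum_strict_mono_ex1) auto
    then have "monom_poly (exponents k ?f') \<in> ?M" using p(2) by (blast intro: lower)
    \<comment> \<open>The exchange y_p m_f = x_p m_f', where m_f' belongs to \<open>?f'\<close>. The
      bounds \<open>0 < f p\<close> and \<open>f p \<le> k\<close> make both truncated subtractions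
      exact.\<close>
    moreover have "Poly_Mapping.single (Y p) 1 + exponents k f
        = Poly_Mapping.single (X p) 1 + exponents k ?f'"
      using p(1) f
      by (intro xy_poly_mapping_eqI) (auto simp: lookup_add lookup_single when_def antitone_maps_def)
    then have "b * ?f = Var (X p) * monom_poly (exponents k ?f')"
      by (simp add: b Var_def mult_single)
    ultimately have "b * ?f \<in> ideal_of ?M" by (simp add: ideal_of_mult ideal_of_base)
    from ideal_of_add[OF ideal_of_mult[OF this] step.IH]
    have "c * (b * ?f) + x * ?f \<in> ideal_of ?M" .
    then show ?case by (simp add: distrib_right mult.assoc)
  qed (simp add: ideal_of_0)
  then show "g \<in> colon_ideal (ideal_of ?M) ?f" by (simp add: colon_ideal_def)
qed

theorem theorem3p6:
  fixes k :: nat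
  assumes "k \<ge> 1"
  shows "has_linear_quotients
           (ideal_power (H_ideal :: ('p::{finite,order} xy_var, 'k::field) polynomial set) k)"
proof -
  obtain es0 :: "('p \<Rightarrow> nat) list" where es0: "set es0 = antitone_maps k" "distinct es0"
    using finite_distinct_list[OF finite_antitone_maps] by blast
  \<comment> \<open>Any enumeration sorted by sum works; the order among equal sums is
    immaterial.\<close>
  define es where "es = sort_key (\<lambda>f. sum f UNIV) es0"
  have set_es: "set es = antitone_maps k" and dist: "distinct es"
    and sorted: "sorted (map (\<lambda>f. sum f UNIV) es)"
    using es0 by (simp_all add: es_def)
  let ?m = "\<lambda>f. monom_poly (exponents k f) :: ('p xy_var, 'k) polynomial"
  let ?fs = "map ?m es"
  have "(\<lambda>p. 0) \<in> antitone_maps k" by (simp add: antitone_maps_def monotone_on_def)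
  then have ne: "es \<noteq> []" using set_es by force
  have deg: "total_degree (?m f) = k * card (UNIV :: 'p set)" if "f \<in> set es" for f
    using that set_es by (simp add: total_degree_monom_poly monomial_degree_exponents antitone_maps_def)
  have "\<exists>L. (\<forall>l\<in>L. linear_form l) \<and> colon_ideal (ideal_of (set (take j ?fs))) (?fs ! j) = ideal_of L"
    if j: "j < length ?fs" for j
  proof -
    let ?f = "es ! j"
    from j have j: "j < length es" by simp
    have "sum e UNIV \<le> sum ?f UNIV" if "e \<in> set (take j es)" for e
      using that j sorted_nth_mono[OF sorted] by (auto simp: in_set_conv_nth)
    moreover have "e \<in> set (take j es)"
      if e: "e \<in> antitone_maps k" "sum e UNIV < sum ?f UNIV" for e
    proof -
      obtain i where i: "i < length es" "es ! i = e" using e(1) set_es by (metis in_set_conv_nth)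
      \<comment> \<open>An entry at position \<open>j\<close> or later has sum at least that of
        \<open>?f\<close>.\<close>
      have "i < j"
        using sorted_nth_mono[OF sorted, of j i] i e(2) by (auto simp: not_le[symmetric])
      with i j show ?thesis by (auto simp: in_set_conv_nth)
    qed
    moreover have "?f \<notin> set (take j es)"
      using dist j by (auto simp: in_set_conv_nth nth_eq_iff_index_eq)
    moreover have "?f \<in> antitone_maps k" "set (take j es) \<subseteq> antitone_maps k"
      using j set_es nth_mem set_take_subset by metis+
    ultimately have "colon_ideal (ideal_of (?m ` set (take j es))) (?m ?f)
        = ideal_of ((\<lambda>p. Var (Y p)) ` {p. 0 < ?f p \<and> ?f(p := ?f p - 1) \<in> antitone_maps k})"
      by (intro colon_ideal_antitone_maps)
    moreover have "set (take j ?fs) = ?m ` set (take j es)" "?fs ! j = ?m ?f"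
      using j by (simp_all add: take_map)
    ultimately show ?thesis using linear_form_Var by (metis (no_types, lifting) imageE)
  qed
  moreover have "map total_degree ?fs = replicate (length es) (k * card (UNIV :: 'p set))"
    using deg by (intro nth_equalityI) auto
  then have "sorted (map total_degree ?fs)" by (simp only: sorted_replicate)
  \<comment> \<open>The common degree \<open>k * card UNIV\<close> is positive because
    \<open>k \<ge> 1\<close> and a type is inhabited.\<close>
  moreover have "0 < total_degree (hd ?fs)"
    using ne assms deg[of "hd es"] by (simp add: hd_map finite_UNIV_card_ge_0)
  ultimately have "linear_quotients_seq ?fs"
    using ne unfolding linear_quotients_seq_def
    by (intro conjI ballI allI impI) (auto simp: homogeneous_monom_poly simp del: nth_map take_map)
  moreover have "ideal_power (H_ideal :: ('p xy_var, 'k) polynomial set) k = ideal_of (set ?fs)"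
    by (simp add: ideal_power_H_ideal set_es)
  ultimately show ?thesis unfolding has_linear_quotients_def by blast
qed

end
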